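(* Let $A \in \mathbb{C}^{n\times n}$ be Hermitian and let $\boldsymbol{u} \in \mathbb{C}^n$ with $\|\boldsymbol{u}\| = 1$. Let $\gamma > 0$ and let $\mu \in \mathbb{R}$ be such that $(\mu, \boldsymbol{u})$ is not an eigenpair of $A$ (i.e., $A\boldsymbol{u} \ne \mu \boldsymbol{u}$). Define the matrices $$B := A - \mu I + i\gamma I \qquad\text{and}\qquad C := A - \mu I + i\gamma (I - \boldsymbol{u}\boldsymbol{u}^\ast).$$ Then both $B$ and $C$ are invertible, and $B^{-1}\boldsymbol{u}$ is a scalar multiple of $C^{-1}\boldsymbol{u}$.
   Context: $\|\cdot\|$ is the Euclidean norm on $\mathbb{C}^n$, $I$ is the $n \times n$ identity matrix, $i$ is the imaginary unit, and $\ast$ denotes conjugate transpose. *)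

theory Defs
  imports "HOL-Analysis.Analysis"
begin

definition conj_transpose :: "complex ^ 'n ^ 'm \<Rightarrow> complex ^ 'm ^ 'n" where
  "conj_transpose M = (\<chi> i j. cnj (M $ j $ i))"

definition hermitian :: "complex ^ 'n ^ 'n \<Rightarrow> bool" where
  "hermitian M \<longleftrightarrow> conj_transpose M = M"

(* The library scales matrices by real numbers only. *)
definition cscale_mat :: "complex \<Rightarrow> complex ^ 'n ^ 'm \<Rightarrow> complex ^ 'n ^ 'm"  (infixr "*\<^sub>C" 75) where
  "c *\<^sub>C M = (\<chi> i j. c * M $ i $ j)"

(* A vector as an n-by-1 matrix. The result type of columnvector leaves the column
   index type open; with more than one column, col u ** conj_transpose (col u) would be
   a multiple of the rank-one matrix u u*. *)
abbreviation col :: "complex ^ 'n \<Rightarrow> complex ^ 1 ^ 'n" where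
  "col u \<equiv> columnvector u"

end

(* With H = A - mu I Hermitian, the form x* H x is real, so the imaginary part of x* B x is
   gamma |x|^2, and that of x* C x is gamma |p|^2 with p = x - (u* x) u. Hence a kernel vector of
   B vanishes, while one of C is a multiple of u annihilated by H, so it vanishes since u is not
   an eigenvector of H for 0. Since C = B - i gamma u u*, the vector x = B^-1 u satisfies
   C x = (1 - i gamma u* x) u, so x is a multiple of C^-1 u. *)
theory Submission
  imports Defs
begin

text \<open>The scalar x* y, conjugate-linear in the first argument. The real inner product
  \<open>inner\<close> is only its real part, whereas the argument rests on imaginary parts.\<close>

definition cinner :: "complex ^ 'n \<Rightarrow> complex ^ 'n \<Rightarrow> complex" where
  "cinner x y = (\<Sum>i\<in>UNIV. cnj (x $ i) * y $ i)"

lemma cinner_add_right: "cinner x (y + z) = cinner x y + cinner x z"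
  by (simp add: cinner_def algebra_simps sum.distrib)

lemma cinner_diff_right: "cinner x (y - z) = cinner x y - cinner x z"
  by (simp add: cinner_def algebra_simps sum_subtractf)

lemma cinner_scale_right: "cinner x (c *s y) = c * cinner x y"
  by (simp add: cinner_def sum_distrib_left mult_ac)

lemma cinner_commute: "cinner y x = cnj (cinner x y)"
  by (simp add: cinner_def mult.commute)

lemma cinner_self: "cinner x x = complex_of_real ((norm x)\<^sup>2)"
proof -
  have "cnj z * z = complex_of_real ((norm z)\<^sup>2)" for z
    by (metis complex_norm_square mult.commute)
  then show ?thesis
    by (simp add: cinner_def norm_vec_def L2_set_def sum_nonneg)
qed

text \<open>Conjugating the double sum for x* M x turns each entry of \<open>M\<close> into the
  transposed one; exchanging the two summations then restores the original sum, so it equals its own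
  conjugate.\<close>

lemma hermitian_cinner_real:
  assumes "hermitian M"
  shows "Im (cinner x (M *v x)) = 0"
proof -
  have M: "cnj (M $ i $ j) = M $ j $ i" for i j
    using assms by (simp add: hermitian_def conj_transpose_def vec_eq_iff)
  have "cnj (cinner x (M *v x)) = (\<Sum>i\<in>UNIV. \<Sum>j\<in>UNIV. x $ i * (M $ j $ i * cnj (x $ j)))"
    by (simp add: cinner_def matrix_vector_mult_def sum_distrib_left M)
  also have "\<dots> = (\<Sum>j\<in>UNIV. \<Sum>i\<in>UNIV. x $ i * (M $ j $ i * cnj (x $ j)))"
    by (rule sum.swap)
  also have "\<dots> = cinner x (M *v x)"
    by (simp add: cinner_def matrix_vector_mult_def sum_distrib_left mult_ac)
  finally show ?thesis
    by (simp add: complex_eq_iff)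
qed

lemma cscale_mat_vector_mult: "(c *\<^sub>C M) *v x = c *s (M *v x)"
  by (simp add: vec_eq_iff cscale_mat_def matrix_vector_mult_def sum_distrib_left mult_ac)

lemma rank_one_vector_mult: "(col u ** conj_transpose (col v)) *v x = cinner v x *s u"
  by (simp add: vec_eq_iff cinner_def matrix_vector_mult_def matrix_matrix_mult_def
      conj_transpose_def columnvector_def sum_distrib_left sum_distrib_right mult_ac)

lemma invertible_if_trivial_kernel:
  fixes M :: "'a::field ^ 'n ^ 'n"
  assumes "\<And>x. M *v x = 0 \<Longrightarrow> x = 0"
  shows "invertible M"
  using assms by (simp add: invertible_left_inverse matrix_left_invertible_ker)

text \<open>\<open>matrix_inv\<close> is a Hilbert choice; invertibility supplies the witness that
  makes the chosen matrix a two-sided inverse.\<close>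

lemma matrix_inv_inverse:
  assumes "invertible M"
  shows "M ** matrix_inv M = mat 1" "matrix_inv M ** M = mat 1"
  using someI_ex[OF assms[unfolded invertible_def]] by (simp_all add: matrix_inv_def)

theorem lemma3p1:
  fixes A B C :: "complex ^ 'n ^ 'n" and u :: "complex ^ 'n" and \<gamma> \<mu> :: real
  assumes "hermitian A"
    and "norm u = 1"
    and "\<gamma> > 0"
    and "A *v u \<noteq> complex_of_real \<mu> *s u"
  defines "B \<equiv> A - complex_of_real \<mu> *\<^sub>C mat 1 + (\<i> * complex_of_real \<gamma>) *\<^sub>C mat 1"
    and "C \<equiv> A - complex_of_real \<mu> *\<^sub>C mat 1
      + (\<i> * complex_of_real \<gamma>) *\<^sub>C (mat 1 - col u ** conj_transpose (col u))"
  shows "invertible B \<and> invertible C \<and>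
    (\<exists>c::complex. matrix_inv B *v u = c *s (matrix_inv C *v u))"
proof -
  define H where "H x = A *v x - complex_of_real \<mu> *s x" for x
  \<comment> \<open>The shift contributes \<mu> |x|^2, which is real because \<mu> is.\<close>
  have H_real: "Im (cinner x (H x)) = 0" for x
    using hermitian_cinner_real[OF assms(1), of x]
    by (simp add: H_def cinner_diff_right cinner_scale_right cinner_self)
  have B: "B *v x = H x + (\<i> * complex_of_real \<gamma>) *s x" for x
    by (simp add: B_def H_def matrix_vector_mult_add_rdistrib matrix_vector_mult_diff_rdistrib
        cscale_mat_vector_mult)
  have C: "C *v x = H x + (\<i> * complex_of_real \<gamma>) *s (x - cinner u x *s u)" for x
    by (simp add: C_def H_def matrix_vector_mult_add_rdistrib matrix_vector_mult_diff_rdistrib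
        cscale_mat_vector_mult rank_one_vector_mult)
  have invB: "invertible B"
  proof (rule invertible_if_trivial_kernel)
    fix x assume "B *v x = 0"
    then have "Im (cinner x (H x + (\<i> * complex_of_real \<gamma>) *s x)) = 0"
      unfolding B by (simp add: cinner_def)
    then show "x = 0"
      using H_real[of x] \<open>\<gamma> > 0\<close>
      by (simp add: cinner_add_right cinner_scale_right cinner_self del: of_real_power)
  qed
  have invC: "invertible C"
  proof (rule invertible_if_trivial_kernel)
    fix x assume Cx: "C *v x = 0"
    \<comment> \<open>The component of \<open>x\<close> orthogonal to \<open>u\<close>; the norm of
      \<open>u\<close> being 1 makes this an orthogonal projection.\<close>
    define p where "p = x - cinner u x *s u"
    have up: "cinner u p = 0"
      using \<open>norm u = 1\<close> by (simp add: p_def cinner_diff_right cinner_scale_right cinner_self)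
    \<comment> \<open>Expanding only the second argument leaves a multiple of p* u, which vanishes
      by orthogonality. Thus p* x = |p|^2, and this real value survives exchanging the
      arguments.\<close>
    have "cinner p p = cinner p x - cinner u x * cinner p u"
      by (subst (2) p_def) (simp add: cinner_diff_right cinner_scale_right)
    also have "\<dots> = cinner p x"
      using up cinner_commute[of p u] by simp
    finally have xp: "cinner x p = complex_of_real ((norm p)\<^sup>2)"
      by (metis cinner_commute cinner_self complex_cnj_complex_of_real)
    have "Im (cinner x (H x + (\<i> * complex_of_real \<gamma>) *s p)) = 0"
      using Cx unfolding C p_def by (simp add: cinner_def)
    then have "p = 0"
      using H_real[of x] \<open>\<gamma> > 0\<close>
      by (simp add: cinner_add_right cinner_scale_right xp del: of_real_power)
    then have x: "x = cinner u x *s u"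
      by (simp add: p_def)
    have "H x = 0"
      using Cx \<open>p = 0\<close> by (simp add: C flip: p_def)
    \<comment> \<open>\<open>x\<close> is now a multiple of \<open>u\<close>, so linearity of
      \<open>H\<close> reduces the claim to the vanishing of its coefficient.\<close>
    moreover have "H x = cinner u x *s H u"
      by (subst x) (simp add: H_def vec.scale vec.scale_right_diff_distrib mult.commute)
    moreover have "H u \<noteq> 0"
      using assms(4) by (simp add: H_def)
    ultimately have "cinner u x = 0"
      by (simp add: vec.scale_eq_0_iff)
    then show "x = 0"
      by (subst x) simp
  qed
  define x where "x = matrix_inv B *v u"
  have "B *v x = u"
    using matrix_inv_inverse[OF invB] by (simp add: x_def matrix_vector_mul_assoc)
  \<comment> \<open>The two matrices differ by a rank-one term with range spanned by
    \<open>u\<close>, so \<open>C\<close> also maps \<open>x\<close> to a multiple of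
    \<open>u\<close>.\<close>
  moreover have "C *v x = B *v x - (\<i> * complex_of_real \<gamma> * cinner u x) *s u"
    by (simp add: B C vec_eq_iff algebra_simps)
  ultimately have "C *v x = (1 - \<i> * complex_of_real \<gamma> * cinner u x) *s u"
    by (simp add: vec_eq_iff algebra_simps)
  then have "matrix_inv C *v (C *v x)
      = (1 - \<i> * complex_of_real \<gamma> * cinner u x) *s (matrix_inv C *v u)"
    by (simp only: vec.scale)
  moreover have "matrix_inv C *v (C *v x) = x"
    using matrix_inv_inverse[OF invC] by (simp add: matrix_vector_mul_assoc)
  \<comment> \<open>The coefficient here is the witness for \<open>c\<close>; it depends on
    \<open>x\<close>, that is, on \<open>B\<close> and \<open>u\<close>.\<close>
  ultimately have "x = (1 - \<i> * complex_of_real \<gamma> * cinner u x) *s (matrix_inv C *v u)"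
    by simp
  then show ?thesis
    using invB invC unfolding x_def by blast
qed

end
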